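(* Consider the scheduling problem (SP) and the equivalent linear program (LP) of the context in the case where the power constraint is tight, $\bar P=p_{max}<\alpha\sum_{m=1}^M\eta_mP_m$. Let $\{y^*_{i,m}\}$ be the optimal solution of (LP), with the threshold structure, thresholds $0=i_1^*\le\cdots\le i_M^*$ and index $\tilde m$ described in the context, let $\pi_i^*=\sum_{m=1}^M\eta_my^*_{i,m}$, and let $\{g^*_{i,m}\},\{f^*_{i,m}\}$ be the optimal transmission probabilities, related to the optimal solution by $y^*_{i,m}=\pi^*_ig^*_{i,m}+\xi\pi^*_{i+1}f^*_{i+1,m}$. Then the pair of optimal transmission probabilities $g^*_{i,m}$ and $f^*_{i+1,m}$ satisfy $$\begin{cases}g^*_{i,m}=f^*_{i+1,m}=0,& i<i_m^*-1,\\ g^*_{i,m}=f^*_{i+1,m}=1,& i\ge i_m^*,\end{cases}$$ for any channel state $m$, and for $i=i_m^*-1$ $$\begin{cases}g^*_{i_m^*-1,m}=f^*_{i_m^*,m}=0,& m\ne\tilde m,\\ \pi^*_{i^*_{\tilde m}-1}g^*_{i^*_{\tilde m}-1,\tilde m}+\xi\pi^*_{i^*_{\tilde m}}f^*_{i^*_{\tilde m},\tilde m}=y^*_{i^*_{\tilde m}-1,\tilde m},& m=\tilde m.\end{cases}$$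
   Context: Data: a positive integer $M$ (number of channel states), $\mathcal M=\{1,\dots,M\}$; $\alpha\in(0,1)$; $\xi=\frac{1-\alpha}{\alpha}$; channel state probabilities $\eta_1,\dots,\eta_M$ with $\sum_m\eta_m=1$; powers $P_1\le\cdots\le P_M$; buffer capacity $Q$, a positive integer or $\infty$; $\mathcal Q=\{0,1,\dots,Q\}$ (all nonnegative integers if $Q=\infty$); a maximum average power $p_{max}$. Scheduling model. Time is slotted. In each slot one packet arrives with probability $\alpha$ (none otherwise), and the channel is in state $m$ with probability $\eta_m$, i.i.d. over slots. If the queue length at the end of the previous slot is $i$ and the channel state is $m$, the source transmits one packet (using power $P_m$) with probability $g_{i,m}$ if a packet arrives in the slot, and with probability $f_{i,m}$ if none arrives (for $i\ge1$; with $i=0$ and no arrival nothing is sent). The queue length is a birth–death Markov chain on $\mathcal Q$ with one-step transition probabilities $\lambda_i=\alpha\sum_m\eta_m(1-g_{i,m})$ from $i$ to $i+1$ ($0\le i\le Q-1$) and $\mu_i=(1-\alpha)\sum_m\eta_mf_{i,m}$ from $i$ to $i-1$ ($1\le i\le Q$), and steady-state probabilities $\{\pi_i\}$. Problem (SP): minimize, over $g_{i,m},f_{i,m}\in[0,1]$, the average delay $\bar D=\frac1\alpha\sum_{i=0}^Qi\pi_i$ subject to $$\bar P=\sum_{m=1}^M\Big(\alpha\sum_{i=0}^Q\pi_i\eta_mg_{i,m}+(1-\alpha)\sum_{i=1}^Q\pi_i\eta_mf_{i,m}\Big)P_m\le p_{max},$$ $\pi_i\lambda_i=\pi_{i+1}\mu_{i+1}$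 for $0\le i<Q$, and $\sum_{i=0}^Q\pi_i=1$. It is assumed that no buffer overflow occurs ($\pi_Q=0$ if $Q<\infty$). (LP), in variables $\{y_{i,m}\}_{i\in\mathcal Q,m\in\mathcal M}$: minimize $\bar D=\frac1\alpha\sum_{i=0}^{Q}\sum_{m=1}^{M}i\eta_my_{i,m}$ subject to (a) $\bar P=\alpha\sum_{i=0}^{Q}\sum_{m=1}^{M}\eta_mP_my_{i,m}\le p_{max}$ (tight means equality); (b) $\sum_{i=0}^{Q}\sum_{m=1}^{M}\eta_my_{i,m}=1$; (c) $0\le y_{i,m}\le\sum_{n=1}^M\eta_ny_{i,n}+\xi\sum_{n=1}^M\eta_ny_{i+1,n}$ for all $i\in\mathcal Q,m\in\mathcal M$. (LP) arises from (SP) by setting $y_{i,m}=\pi_ig_{i,m}+\xi\pi_{i+1}f_{i+1,m}$, under which $\pi_i=\sum_m\eta_my_{i,m}$. Threshold structure of the optimal solution of (LP): there are thresholds $0=i_1^*\le\cdots\le i_M^*$ such that $y^*_{i,m}=0$ for $i<i_m^*-1$ and $y^*_{i,m}=\pi_i^*+\xi\pi_{i+1}^*$ for $i\ge i_m^*$; and there is at most one $\tilde m\in\{2,\dots,M\}$ such that $y^*_{i^*_{\tilde m}-1,\tilde m}>0$ may hold, with $y^*_{i_m^*-1,m}=0$ for $m\in\{2,\dots,M\}\setminus\{\tilde m\}$. In the claim, $\tilde m$ is this index. Quantities $y_{i,m},\pi_i$ with $i$ outside $\mathcal Q$ are read as $0$, and assertions about $g_{i,m}$ or $f_{i,m}$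 with queue index outside the range of the model ($0\le i\le Q$ for $g$, $1\le i\le Q$ for $f$) are void.
   Formalization: For every optimal g*, f* related to y*, the individual values 0 and 1 are claimed only at queue lengths with π*_i > 0, since elsewhere optimality leaves them arbitrary; in addition, some optimal related g*, f* is shown to satisfy the claim at all queue lengths. *)

theory Defs
  imports "HOL-Analysis.Analysis"
begin

definition queue_states :: "enat \<Rightarrow> nat set" where
  "queue_states Q = {i. enat i \<le> Q}"

definition odds :: "real \<Rightarrow> real" where
  "odds \<alpha> = (1 - \<alpha>) / \<alpha>"

definition up_rate :: "nat \<Rightarrow> real \<Rightarrow> (nat \<Rightarrow> real) \<Rightarrow> (nat \<Rightarrow> nat \<Rightarrow> real) \<Rightarrow> nat \<Rightarrow> real" where
  "up_rate M \<alpha> \<eta> g i = \<alpha> * (\<Sum>m=1..M. \<eta> m * (1 - g i m))"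

definition down_rate :: "nat \<Rightarrow> real \<Rightarrow> (nat \<Rightarrow> real) \<Rightarrow> (nat \<Rightarrow> nat \<Rightarrow> real) \<Rightarrow> nat \<Rightarrow> real" where
  "down_rate M \<alpha> \<eta> f i = (1 - \<alpha>) * (\<Sum>m=1..M. \<eta> m * f i m)"

definition sp_power ::
    "nat \<Rightarrow> real \<Rightarrow> (nat \<Rightarrow> real) \<Rightarrow> (nat \<Rightarrow> real) \<Rightarrow> enat \<Rightarrow>
     (nat \<Rightarrow> nat \<Rightarrow> real) \<Rightarrow> (nat \<Rightarrow> nat \<Rightarrow> real) \<Rightarrow> (nat \<Rightarrow> real) \<Rightarrow> real" where
  "sp_power M \<alpha> \<eta> P Q g f \<pi> =
     (\<Sum>m=1..M. (\<alpha> * (\<Sum>\<^sub>\<infinity>i\<in>queue_states Q. \<pi> i * \<eta> m * g i m)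
               + (1 - \<alpha>) * (\<Sum>\<^sub>\<infinity>i\<in>queue_states Q - {0}. \<pi> i * \<eta> m * f i m)) * P m)"

text \<open>For an infinite buffer the average delay may be infinite, so it takes extended values.\<close>

definition sp_delay :: "real \<Rightarrow> enat \<Rightarrow> (nat \<Rightarrow> real) \<Rightarrow> ennreal" where
  "sp_delay \<alpha> Q \<pi> = (\<Sum>\<^sub>\<infinity>i\<in>queue_states Q. ennreal (real i * \<pi> i)) / ennreal \<alpha>"

text \<open>
  The stationary distribution is carried along with the transmission probabilities, because the
  balance equations need not determine it when some of the rates vanish. The last conjunct
  is the assumption that no buffer overflow occurs. An infinite sum of reals that does not
  converge has value 0, so the normalisation includes summability.
\<close>

definition sp_feasible ::
    "nat \<Rightarrow> real \<Rightarrow> (nat \<Rightarrow> real) \<Rightarrow> (nat \<Rightarrow> real) \<Rightarrow> enat \<Rightarrow> real \<Rightarrow>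
     (nat \<Rightarrow> nat \<Rightarrow> real) \<Rightarrow> (nat \<Rightarrow> nat \<Rightarrow> real) \<Rightarrow> (nat \<Rightarrow> real) \<Rightarrow> bool" where
  "sp_feasible M \<alpha> \<eta> P Q pmax g f \<pi> \<longleftrightarrow>
     (\<forall>i\<in>queue_states Q. \<forall>m\<in>{1..M}. 0 \<le> g i m \<and> g i m \<le> 1) \<and>
     (\<forall>i\<in>queue_states Q - {0}. \<forall>m\<in>{1..M}. 0 \<le> f i m \<and> f i m \<le> 1) \<and>
     (\<forall>i\<in>queue_states Q. 0 \<le> \<pi> i) \<and>
     (\<Sum>\<^sub>\<infinity>i\<in>queue_states Q. \<pi> i) = 1 \<and>
     (\<forall>i. enat i < Q \<longrightarrow> \<pi> i * up_rate M \<alpha> \<eta> g i = \<pi> (i + 1) * down_rate M \<alpha> \<eta> f (i + 1)) \<and>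
     sp_power M \<alpha> \<eta> P Q g f \<pi> \<le> pmax \<and>
     (\<forall>i. enat i = Q \<longrightarrow> \<pi> i = 0)"

definition sp_optimal ::
    "nat \<Rightarrow> real \<Rightarrow> (nat \<Rightarrow> real) \<Rightarrow> (nat \<Rightarrow> real) \<Rightarrow> enat \<Rightarrow> real \<Rightarrow>
     (nat \<Rightarrow> nat \<Rightarrow> real) \<Rightarrow> (nat \<Rightarrow> nat \<Rightarrow> real) \<Rightarrow> (nat \<Rightarrow> real) \<Rightarrow> bool" where
  "sp_optimal M \<alpha> \<eta> P Q pmax g f \<pi> \<longleftrightarrow>
     sp_feasible M \<alpha> \<eta> P Q pmax g f \<pi> \<and>
     (\<forall>g' f' \<pi>'. sp_feasible M \<alpha> \<eta> P Q pmax g' f' \<pi>' \<longrightarrow> sp_delay \<alpha> Q \<pi> \<le> sp_delay \<alpha> Q \<pi>')"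

text \<open>Quantities indexed by a queue length outside the buffer range are read as 0.\<close>

definition occupancy :: "nat \<Rightarrow> (nat \<Rightarrow> real) \<Rightarrow> enat \<Rightarrow> (nat \<Rightarrow> nat \<Rightarrow> real) \<Rightarrow> nat \<Rightarrow> real" where
  "occupancy M \<eta> Q y i = (if i \<in> queue_states Q then \<Sum>m=1..M. \<eta> m * y i m else 0)"

definition lp_power ::
    "nat \<Rightarrow> real \<Rightarrow> (nat \<Rightarrow> real) \<Rightarrow> (nat \<Rightarrow> real) \<Rightarrow> enat \<Rightarrow> (nat \<Rightarrow> nat \<Rightarrow> real) \<Rightarrow> real" where
  "lp_power M \<alpha> \<eta> P Q y = \<alpha> * (\<Sum>\<^sub>\<infinity>i\<in>queue_states Q. \<Sum>m=1..M. \<eta> m * P m * y i m)"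

definition lp_delay ::
    "nat \<Rightarrow> real \<Rightarrow> (nat \<Rightarrow> real) \<Rightarrow> enat \<Rightarrow> (nat \<Rightarrow> nat \<Rightarrow> real) \<Rightarrow> ennreal" where
  "lp_delay M \<alpha> \<eta> Q y =
     (\<Sum>\<^sub>\<infinity>i\<in>queue_states Q. \<Sum>m=1..M. ennreal (real i * \<eta> m * y i m)) / ennreal \<alpha>"

definition lp_feasible ::
    "nat \<Rightarrow> real \<Rightarrow> (nat \<Rightarrow> real) \<Rightarrow> (nat \<Rightarrow> real) \<Rightarrow> enat \<Rightarrow> real \<Rightarrow> (nat \<Rightarrow> nat \<Rightarrow> real) \<Rightarrow> bool" where
  "lp_feasible M \<alpha> \<eta> P Q pmax y \<longleftrightarrow>
     lp_power M \<alpha> \<eta> P Q y \<le> pmax \<and>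
     (\<Sum>\<^sub>\<infinity>i\<in>queue_states Q. \<Sum>m=1..M. \<eta> m * y i m) = 1 \<and>
     (\<forall>i\<in>queue_states Q. \<forall>m\<in>{1..M}.
        0 \<le> y i m \<and> y i m \<le> occupancy M \<eta> Q y i + odds \<alpha> * occupancy M \<eta> Q y (i + 1))"

definition lp_optimal ::
    "nat \<Rightarrow> real \<Rightarrow> (nat \<Rightarrow> real) \<Rightarrow> (nat \<Rightarrow> real) \<Rightarrow> enat \<Rightarrow> real \<Rightarrow> (nat \<Rightarrow> nat \<Rightarrow> real) \<Rightarrow> bool" where
  "lp_optimal M \<alpha> \<eta> P Q pmax y \<longleftrightarrow>
     lp_feasible M \<alpha> \<eta> P Q pmax y \<and>
     (\<forall>y'. lp_feasible M \<alpha> \<eta> P Q pmax y' \<longrightarrow> lp_delay M \<alpha> \<eta> Q y \<le> lp_delay M \<alpha> \<eta> Q y')"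

text \<open>
  The exceptional channel state, at most one, is an option: \<^term>\<open>None\<close> means that there is none.
  The queue length just below a threshold is written as an \<open>i\<close> with \<open>i + 1 = th m\<close>, which makes
  the clause void for a zero threshold.
\<close>

definition threshold_structure ::
    "nat \<Rightarrow> real \<Rightarrow> (nat \<Rightarrow> real) \<Rightarrow> enat \<Rightarrow> (nat \<Rightarrow> nat \<Rightarrow> real) \<Rightarrow> (nat \<Rightarrow> nat) \<Rightarrow> nat option \<Rightarrow> bool" where
  "threshold_structure M \<alpha> \<eta> Q y th mt \<longleftrightarrow>
     th 1 = 0 \<and> mono_on {1..M} th \<and>
     (\<forall>m\<in>{1..M}. \<forall>i\<in>queue_states Q.
        (i + 1 < th m \<longrightarrow> y i m = 0) \<and>
        (th m \<le> i \<longrightarrow> y i m = occupancy M \<eta> Q y i + odds \<alpha> * occupancy M \<eta> Q y (i + 1))) \<and>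
     set_option mt \<subseteq> {2..M} \<and>
     (\<forall>m\<in>{2..M} - set_option mt. \<forall>i\<in>queue_states Q. i + 1 = th m \<longrightarrow> y i m = 0)"

definition transmission_relation ::
    "nat \<Rightarrow> real \<Rightarrow> (nat \<Rightarrow> real) \<Rightarrow> enat \<Rightarrow> (nat \<Rightarrow> nat \<Rightarrow> real) \<Rightarrow>
     (nat \<Rightarrow> nat \<Rightarrow> real) \<Rightarrow> (nat \<Rightarrow> nat \<Rightarrow> real) \<Rightarrow> bool" where
  "transmission_relation M \<alpha> \<eta> Q y g f \<longleftrightarrow>
     (\<forall>i\<in>queue_states Q. \<forall>m\<in>{1..M}.
        y i m = occupancy M \<eta> Q y i * g i m + odds \<alpha> * occupancy M \<eta> Q y (i + 1) * f (i + 1) m)"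

text \<open>
  The set \<open>V\<close> restricts the queue lengths at which \<open>g\<close> and \<open>f\<close> are prescribed individually: at a
  queue length of stationary probability 0, optimality leaves them arbitrary.
\<close>

definition threshold_policy_on ::
    "nat set \<Rightarrow> nat \<Rightarrow> real \<Rightarrow> (nat \<Rightarrow> real) \<Rightarrow> enat \<Rightarrow> (nat \<Rightarrow> nat \<Rightarrow> real) \<Rightarrow>
     (nat \<Rightarrow> nat) \<Rightarrow> nat option \<Rightarrow> (nat \<Rightarrow> nat \<Rightarrow> real) \<Rightarrow> (nat \<Rightarrow> nat \<Rightarrow> real) \<Rightarrow> bool" where
  "threshold_policy_on V M \<alpha> \<eta> Q y th mt g f \<longleftrightarrow>
     (\<forall>m\<in>{1..M}. \<forall>i\<in>queue_states Q.
        (i + 1 < th m \<longrightarrow> (i \<in> V \<longrightarrow> g i m = 0) \<and> (i + 1 \<in> V \<longrightarrow> f (i + 1) m = 0)) \<and>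
        (th m \<le> i \<longrightarrow> (i \<in> V \<longrightarrow> g i m = 1) \<and> (i + 1 \<in> V \<longrightarrow> f (i + 1) m = 1)) \<and>
        (i + 1 = th m \<and> mt \<noteq> Some m \<longrightarrow>
           (i \<in> V \<longrightarrow> g i m = 0) \<and> (i + 1 \<in> V \<longrightarrow> f (i + 1) m = 0)) \<and>
        (i + 1 = th m \<and> mt = Some m \<longrightarrow>
           occupancy M \<eta> Q y i * g i m + odds \<alpha> * occupancy M \<eta> Q y (i + 1) * f (i + 1) m = y i m))"

end

theory Submission imports Defs begin

text \<open>
  The map \<open>y i m = \<pi> i * g i m + \<xi> * \<pi> (i + 1) * f (i + 1) m\<close> sends feasible points of (SP) to feasible
  points of (LP) with the same power and delay, the balance equations being exactly
  \<open>\<pi> i = (\<Sum>m. \<eta> m * y i m)\<close>. Conversely, splitting \<open>y\<close> with one common ratio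
  \<open>g i m = f (i + 1) m = y i m / (\<pi> i + \<xi> * \<pi> (i + 1))\<close> turns an optimal solution of (LP) into one of (SP).
  The values of \<open>g\<close> and \<open>f\<close> are forced where \<open>y i m\<close> attains one of its bounds, because both
  transmission probabilities lie in \<open>[0, 1]\<close>.
\<close>

section \<open>The buffer range and shifted sums\<close>

lemma Suc_in_queue_states: "Suc i \<in> queue_states Q \<Longrightarrow> i \<in> queue_states Q"
  unfolding queue_states_def using order_trans[of "enat i" "enat (Suc i)" Q] by simp

lemma Suc_in_queue_states_iff: "Suc i \<in> queue_states Q \<longleftrightarrow> enat i < Q"
  by (cases Q) (auto simp: queue_states_def)

lemma odds_pos: "0 < \<alpha> \<Longrightarrow> \<alpha> < 1 \<Longrightarrow> 0 < odds \<alpha>"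
  by (simp add: odds_def)

lemma occupancy_nonneg:
  assumes "\<forall>m\<in>{1..M}. 0 \<le> \<eta> m" "\<forall>i\<in>queue_states Q. \<forall>m\<in>{1..M}. 0 \<le> y i m"
  shows "0 \<le> occupancy M \<eta> Q y i"
  using assms by (auto simp: occupancy_def intro!: sum_nonneg)

text \<open>Reindexing by \<open>Suc\<close>: (SP) sums the power spent without arrivals over the
  nonempty queue lengths, whereas (LP) books it one index lower. A full finite buffer has no
  successor in range, hence the padding by 0.\<close>

lemma has_sum_shift:
  fixes h :: "nat \<Rightarrow> real"
  assumes "h summable_on (queue_states Q - {0})"
  shows "((\<lambda>i. if Suc i \<in> queue_states Q then h (Suc i) else 0)
           has_sum infsum h (queue_states Q - {0})) (queue_states Q)"
proof -
  have "queue_states Q - {0} = Suc ` {i. Suc i \<in> queue_states Q}"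
    by (auto simp: image_iff) (metis not0_implies_Suc)
  then have "((h \<circ> Suc) has_sum infsum h (queue_states Q - {0})) {i. Suc i \<in> queue_states Q}"
    using has_sum_infsum[OF assms] by (simp add: has_sum_reindex)
  then show ?thesis
    by (rule has_sum_cong_neutral[THEN iffD1, rotated -1]) (auto dest: Suc_in_queue_states)
qed

lemma has_sum_finite_sum:
  fixes h :: "'a \<Rightarrow> 'b \<Rightarrow> 'c::topological_comm_monoid_add"
  assumes "finite F" "\<And>m. m \<in> F \<Longrightarrow> (h m has_sum s m) A"
  shows "((\<lambda>i. \<Sum>m\<in>F. h m i) has_sum (\<Sum>m\<in>F. s m)) A"
  using assms by (induction F rule: finite_induct) (auto intro: has_sum_add)

section \<open>Power, delay and balance in the two problems\<close>

text \<open>The powers agree for each channel state because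
  \<open>\<alpha> * odds \<alpha> = 1 - \<alpha>\<close>. The conditional in the hypothesis on
  \<open>y\<close> reads \<open>p\<close> as 0 beyond the buffer, where the stationary distribution
  of (SP) is unconstrained.\<close>

lemma sp_power_eq_lp_power:
  assumes "0 < \<alpha>"
    and g: "\<forall>i\<in>queue_states Q. \<forall>m\<in>{1..M}. 0 \<le> g i m \<and> g i m \<le> 1"
    and f: "\<forall>i\<in>queue_states Q - {0}. \<forall>m\<in>{1..M}. 0 \<le> f i m \<and> f i m \<le> 1"
    and p: "\<forall>i\<in>queue_states Q. 0 \<le> p i" and sum_p: "p summable_on queue_states Q"
    and y: "\<And>i m. i \<in> queue_states Q \<Longrightarrow> m \<in> {1..M} \<Longrightarrow>
      y i m = p i * g i m + odds \<alpha> * (if Suc i \<in> queue_states Q then p (Suc i) else 0) * f (Suc i) m"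
  shows "sp_power M \<alpha> \<eta> P Q g f p = lp_power M \<alpha> \<eta> P Q y"
proof -
  let ?A = "queue_states Q"
  define G where "G m = (\<Sum>\<^sub>\<infinity>i\<in>?A. p i * g i m)" for m
  define F where "F m = (\<Sum>\<^sub>\<infinity>i\<in>?A - {0}. p i * f i m)" for m
  have Y: "((\<lambda>i. y i m) has_sum (G m + odds \<alpha> * F m)) ?A" if m: "m \<in> {1..M}" for m
  proof -
    have "(\<lambda>i. p i * g i m) summable_on ?A"
      by (rule summable_on_comparison_test[OF sum_p])
        (use g p m in \<open>auto intro!: mult_left_le\<close>)
    then have Gs: "((\<lambda>i. p i * g i m) has_sum G m) ?A"
      unfolding G_def by (rule has_sum_infsum)
    have "(\<lambda>i. p i * f i m) summable_on (?A - {0})"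
      by (rule summable_on_comparison_test[OF summable_on_subset_banach[OF sum_p]])
        (use f p m in \<open>auto intro!: mult_left_le\<close>)
    from has_sum_shift[OF this]
    have Fs: "((\<lambda>i. if Suc i \<in> ?A then p (Suc i) * f (Suc i) m else 0) has_sum F m) ?A"
      unfolding F_def .
    show ?thesis
      using has_sum_add[OF Gs has_sum_cmult_right[OF Fs, of "odds \<alpha>"]]
      by (rule has_sum_cong[THEN iffD1, rotated]) (use y m in auto)
  qed
  have "((\<lambda>i. \<Sum>m=1..M. \<eta> m * P m * y i m) has_sum
          (\<Sum>m=1..M. \<eta> m * P m * (G m + odds \<alpha> * F m))) ?A"
    by (intro has_sum_finite_sum has_sum_cmult_right Y) auto
  then have "lp_power M \<alpha> \<eta> P Q y = \<alpha> * (\<Sum>m=1..M. \<eta> m * P m * (G m + odds \<alpha> * F m))"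
    by (simp add: lp_power_def infsumI)
  also have "\<dots> = (\<Sum>m=1..M. (\<alpha> * (\<eta> m * G m) + (1 - \<alpha>) * (\<eta> m * F m)) * P m)"
    unfolding sum_distrib_left using \<open>0 < \<alpha>\<close>
    by (intro sum.cong) (simp_all add: odds_def field_simps)
  also have "\<dots> = sp_power M \<alpha> \<eta> P Q g f p"
  proof -
    have "(\<Sum>\<^sub>\<infinity>i\<in>?A. p i * \<eta> m * g i m) = \<eta> m * G m"
      and "(\<Sum>\<^sub>\<infinity>i\<in>?A - {0}. p i * \<eta> m * f i m) = \<eta> m * F m" for m
      unfolding G_def F_def by (simp_all only: infsum_cmult_right'[symmetric] ac_simps)
    then show ?thesis by (simp add: sp_power_def)
  qed
  finally show ?thesis by simp
qed

text \<open>Nonnegativity lets \<open>ennreal\<close> commute with the sum over the channel states,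
  so the equality also covers infinite delays.\<close>

lemma sp_delay_occupancy:
  assumes "\<forall>m\<in>{1..M}. 0 \<le> \<eta> m" "\<forall>i\<in>queue_states Q. \<forall>m\<in>{1..M}. 0 \<le> y i m"
  shows "sp_delay \<alpha> Q (occupancy M \<eta> Q y) = lp_delay M \<alpha> \<eta> Q y"
proof -
  have "ennreal (real i * occupancy M \<eta> Q y i) = (\<Sum>m=1..M. ennreal (real i * \<eta> m * y i m))"
    if "i \<in> queue_states Q" for i
    using assms that by (subst sum_ennreal) (auto simp: occupancy_def sum_distrib_left ac_simps)
  then show ?thesis
    unfolding sp_delay_def lp_delay_def by (simp cong: infsum_cong)
qed

text \<open>As the \<open>\<eta> m\<close> sum to 1, \<open>up_rate\<close> is
  \<open>\<alpha>\<close> times one minus the channel average of \<open>g\<close>; dividing the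
  balance equation by \<open>\<alpha>\<close> and rearranging gives the right-hand side. The passage
  from (SP) to (LP) uses one implication, the way back the other.\<close>

lemma balance_iff:
  assumes "0 < \<alpha>" "(\<Sum>m=1..M. \<eta> m) = 1"
  shows "a * up_rate M \<alpha> \<eta> g i = b * down_rate M \<alpha> \<eta> f j \<longleftrightarrow>
    (\<Sum>m=1..M. \<eta> m * (a * g i m + odds \<alpha> * b * f j m)) = a"
proof -
  let ?G = "\<Sum>m=1..M. \<eta> m * g i m" and ?F = "\<Sum>m=1..M. \<eta> m * f j m"
  have up: "up_rate M \<alpha> \<eta> g i = \<alpha> * (1 - ?G)"
    using assms by (simp add: up_rate_def algebra_simps sum_subtractf)
  have mean: "(\<Sum>m=1..M. \<eta> m * (a * g i m + odds \<alpha> * b * f j m)) = a * ?G + odds \<alpha> * b * ?F"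
    by (simp add: sum_distrib_left sum.distrib algebra_simps)
  have "a * (\<alpha> * (1 - G)) = b * ((1 - \<alpha>) * F) \<longleftrightarrow> a * G + odds \<alpha> * b * F = a" for G F
    using assms(1) by (auto simp: odds_def field_simps)
  then show ?thesis
    unfolding up mean down_rate_def .
qed

section \<open>Transfer of feasibility and optimality\<close>

text \<open>This makes the optimal delay of (LP) a lower bound for the delay of every feasible
  policy in (SP).\<close>

lemma sp_feasible_imp_lp_feasible:
  assumes "0 < \<alpha>" "\<alpha> < 1" and \<eta>: "\<forall>m\<in>{1..M}. 0 \<le> \<eta> m" "(\<Sum>m=1..M. \<eta> m) = 1"
    and sp: "sp_feasible M \<alpha> \<eta> P Q pmax g f \<pi>"
  obtains y where "lp_feasible M \<alpha> \<eta> P Q pmax y" "lp_delay M \<alpha> \<eta> Q y = sp_delay \<alpha> Q \<pi>"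
proof -
  let ?A = "queue_states Q"
  \<comment> \<open>\<open>q\<close> is \<open>\<pi>\<close> extended by 0: feasibility says nothing
    about \<open>\<pi>\<close> beyond the buffer, while \<open>occupancy\<close> is 0 there.\<close>
  define q where "q i = (if i \<in> ?A then \<pi> i else 0)" for i
  define y where "y i m = \<pi> i * g i m + odds \<alpha> * q (Suc i) * f (Suc i) m" for i m
  have g: "\<forall>i\<in>?A. \<forall>m\<in>{1..M}. 0 \<le> g i m \<and> g i m \<le> 1"
    and f: "\<forall>i\<in>?A - {0}. \<forall>m\<in>{1..M}. 0 \<le> f i m \<and> f i m \<le> 1"
    and \<pi>: "\<forall>i\<in>?A. 0 \<le> \<pi> i" and norm: "(\<Sum>\<^sub>\<infinity>i\<in>?A. \<pi> i) = 1"
    and bal: "\<And>i. enat i < Q \<Longrightarrow> \<pi> i * up_rate M \<alpha> \<eta> g i = \<pi> (i + 1) * down_rate M \<alpha> \<eta> f (i + 1)"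
    and pow: "sp_power M \<alpha> \<eta> P Q g f \<pi> \<le> pmax" and top: "\<And>i. enat i = Q \<Longrightarrow> \<pi> i = 0"
    using sp unfolding sp_feasible_def by blast+
  have occ: "occupancy M \<eta> Q y i = q i" for i
  proof (cases "i \<in> ?A")
    case True
    show ?thesis
    proof (cases "enat i < Q")
      case True
      then have "Suc i \<in> ?A" by (simp add: Suc_in_queue_states_iff)
      then show ?thesis
        using bal[OF True] \<open>i \<in> ?A\<close> balance_iff[OF assms(1) \<eta>(2), of "\<pi> i" g i]
        by (simp add: occupancy_def y_def q_def)
    next
      \<comment> \<open>Here \<open>i\<close> is the full buffer, which has no balance equation.
        Absence of overflow gives \<open>\<pi> i = 0\<close>, and both sides vanish.\<close>
      case False
      then have "Suc i \<notin> ?A" "\<pi> i = 0"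
        using \<open>i \<in> ?A\<close> top by (auto simp: Suc_in_queue_states_iff queue_states_def)
      then show ?thesis by (simp add: occupancy_def y_def q_def)
    qed
  qed (simp add: occupancy_def q_def)
  have bounds: "0 \<le> y i m \<and> y i m \<le> q i + odds \<alpha> * q (Suc i)"
    if "i \<in> ?A" "m \<in> {1..M}" for i m
  proof -
    have "0 \<le> \<pi> i * g i m" "\<pi> i * g i m \<le> q i"
      using that \<pi> g by (auto simp: q_def intro: mult_left_le)
    moreover have "0 \<le> q (Suc i) * f (Suc i) m" "q (Suc i) * f (Suc i) m \<le> q (Suc i)"
      using that \<pi> f by (auto simp: q_def intro: mult_left_le)
    ultimately show ?thesis
      using odds_pos[OF assms(1,2)] unfolding y_def mult.assoc
      by (auto intro!: add_mono mult_left_mono)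
  qed
  \<comment> \<open>A divergent real \<open>infsum\<close> would have the default value 0, not
    1.\<close>
  have "\<pi> summable_on ?A"
    using norm infsum_not_exists by fastforce
  then have "sp_power M \<alpha> \<eta> P Q g f \<pi> = lp_power M \<alpha> \<eta> P Q y"
    using assms(1) g f \<pi> by (intro sp_power_eq_lp_power) (auto simp: y_def q_def)
  moreover have "(\<Sum>\<^sub>\<infinity>i\<in>?A. \<Sum>m=1..M. \<eta> m * y i m) = 1"
  proof -
    have "(\<Sum>m=1..M. \<eta> m * y i m) = \<pi> i" if "i \<in> ?A" for i
      using occ[of i] that by (simp add: occupancy_def q_def)
    then show ?thesis using norm by (simp cong: infsum_cong)
  qed
  ultimately have "lp_feasible M \<alpha> \<eta> P Q pmax y"
    using pow bounds by (simp add: lp_feasible_def occ)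
  moreover have "lp_delay M \<alpha> \<eta> Q y = sp_delay \<alpha> Q \<pi>"
    using sp_delay_occupancy[of M \<eta> Q y \<alpha>] \<eta> bounds
    by (simp add: sp_delay_def occ q_def cong: infsum_cong)
  ultimately show ?thesis by (rule that)
qed

text \<open>Every admissible splitting of \<open>y\<close> is feasible for (SP) with the delay of
  \<open>y\<close>. A competitor with smaller delay would yield, by
  \<open>sp_feasible_imp_lp_feasible\<close>, a point of (LP) better than \<open>y\<close>.\<close>

lemma lp_optimal_imp_sp_optimal:
  assumes "0 < \<alpha>" "\<alpha> < 1" and \<eta>: "\<forall>m\<in>{1..M}. 0 \<le> \<eta> m" "(\<Sum>m=1..M. \<eta> m) = 1"
    and opt: "lp_optimal M \<alpha> \<eta> P Q pmax y"
    and top: "\<forall>i. enat i = Q \<longrightarrow> occupancy M \<eta> Q y i = 0"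
    and g: "\<forall>i\<in>queue_states Q. \<forall>m\<in>{1..M}. 0 \<le> g i m \<and> g i m \<le> 1"
    and f: "\<forall>i\<in>queue_states Q - {0}. \<forall>m\<in>{1..M}. 0 \<le> f i m \<and> f i m \<le> 1"
    and rel: "transmission_relation M \<alpha> \<eta> Q y g f"
  shows "sp_optimal M \<alpha> \<eta> P Q pmax g f (occupancy M \<eta> Q y)"
proof -
  let ?A = "queue_states Q" and ?p = "occupancy M \<eta> Q y"
  have lp: "lp_feasible M \<alpha> \<eta> P Q pmax y"
    and least: "\<And>y'. lp_feasible M \<alpha> \<eta> P Q pmax y' \<Longrightarrow> lp_delay M \<alpha> \<eta> Q y \<le> lp_delay M \<alpha> \<eta> Q y'"
    using opt by (auto simp: lp_optimal_def)
  have y: "\<forall>i\<in>?A. \<forall>m\<in>{1..M}. 0 \<le> y i m"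
    using lp by (simp add: lp_feasible_def)
  have norm: "infsum ?p ?A = 1"
    using lp by (simp add: lp_feasible_def occupancy_def cong: infsum_cong)
  then have "?p summable_on ?A"
    using infsum_not_exists by fastforce
  moreover have "(if Suc i \<in> ?A then ?p (Suc i) else 0) = ?p (Suc i)" for i
    by (simp add: occupancy_def)
  ultimately have "sp_power M \<alpha> \<eta> P Q g f ?p = lp_power M \<alpha> \<eta> P Q y"
    using assms(1) g f occupancy_nonneg[OF \<eta>(1) y] rel
    by (intro sp_power_eq_lp_power) (simp_all add: transmission_relation_def)
  moreover have "?p i * up_rate M \<alpha> \<eta> g i = ?p (i + 1) * down_rate M \<alpha> \<eta> f (i + 1)"
    if "enat i < Q" for i
  proof -
    have i: "i \<in> ?A" using that by (simp add: queue_states_def)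
    \<comment> \<open>Averaging \<open>transmission_relation\<close> over the channel gives the
      right-hand side of \<open>balance_iff\<close>.\<close>
    have "(\<Sum>m=1..M. \<eta> m * (?p i * g i m + odds \<alpha> * ?p (i + 1) * f (i + 1) m))
            = (\<Sum>m=1..M. \<eta> m * y i m)"
      using rel i by (intro sum.cong) (auto simp: transmission_relation_def)
    then show ?thesis
      using i by (simp add: balance_iff[OF assms(1) \<eta>(2)] occupancy_def)
  qed
  ultimately have "sp_feasible M \<alpha> \<eta> P Q pmax g f ?p"
    using g f top norm lp occupancy_nonneg[OF \<eta>(1) y]
    by (simp add: sp_feasible_def lp_feasible_def)
  moreover have "sp_delay \<alpha> Q ?p \<le> sp_delay \<alpha> Q \<pi>'"
    if "sp_feasible M \<alpha> \<eta> P Q pmax g' f' \<pi>'" for g' f' \<pi>'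
    using sp_feasible_imp_lp_feasible[OF assms(1-4) that] least sp_delay_occupancy[OF \<eta>(1) y]
    by metis
  ultimately show ?thesis by (simp add: sp_optimal_def)
qed

section \<open>Transmission probabilities forced by the bounds on \<open>y\<close>\<close>

text \<open>The signs of \<open>s\<close> and \<open>t\<close> are tied to positive weights because
  \<open>t\<close> will come from \<open>f (Suc i) m\<close>, whose bounds hold only inside the
  buffer; a positive weight puts \<open>Suc i\<close> there.\<close>

lemma combination_eq_0D:
  fixes a b :: real
  assumes "a * s + b * t = 0" "0 \<le> a" "0 \<le> b" "0 < a \<Longrightarrow> 0 \<le> s" "0 < b \<Longrightarrow> 0 \<le> t"
  shows "(0 < a \<longrightarrow> s = 0) \<and> (0 < b \<longrightarrow> t = 0)"
proof -
  have "0 \<le> a * s" "0 \<le> b * t"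
    using assms by (auto simp: zero_le_mult_iff less_le)
  then have "a * s = 0" "b * t = 0" using assms(1) by linarith+
  then show ?thesis by auto
qed

text \<open>The structure states this for channel states from 2 on. State 1 cannot occur, since its
  threshold is 0 and hence not of the form \<open>i + 1\<close>.\<close>

lemma threshold_structure_below:
  assumes "threshold_structure M \<alpha> \<eta> Q y th mt" "i \<in> queue_states Q" "m \<in> {1..M}"
    and "i + 1 = th m" "mt \<noteq> Some m"
  shows "y i m = 0"
proof -
  have "m \<noteq> 1" using assms(1,4) by (auto simp: threshold_structure_def)
  then have "m \<in> {2..M} - set_option mt" using assms(3,5) by auto
  then show ?thesis using assms unfolding threshold_structure_def by blast
qed

text \<open>The clause for the exceptional state is an instance of
  \<open>transmission_relation\<close>, so only the prescribed values 0 and 1 remain to be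
  checked.\<close>

lemma threshold_policy_onI:
  assumes "\<And>m i. m \<in> {1..M} \<Longrightarrow> i \<in> queue_states Q \<Longrightarrow> i + 1 < th m \<or> i + 1 = th m \<and> mt \<noteq> Some m \<Longrightarrow>
      (i \<in> V \<longrightarrow> g i m = 0) \<and> (i + 1 \<in> V \<longrightarrow> f (i + 1) m = 0)"
    and "\<And>m i. m \<in> {1..M} \<Longrightarrow> i \<in> queue_states Q \<Longrightarrow> th m \<le> i \<Longrightarrow>
      (i \<in> V \<longrightarrow> g i m = 1) \<and> (i + 1 \<in> V \<longrightarrow> f (i + 1) m = 1)"
    and "transmission_relation M \<alpha> \<eta> Q y g f"
  shows "threshold_policy_on V M \<alpha> \<eta> Q y th mt g f"
  unfolding threshold_policy_on_def
proof (intro ballI, goal_cases)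
  case (1 m i)
  then show ?case
    using assms(1,2)[of m i] assms(3)[unfolded transmission_relation_def, THEN bspec, THEN bspec, of i m]
    by metis
qed

lemma threshold_policy_forced:
  assumes "0 < \<alpha>" "\<alpha> < 1"
    and nonneg: "\<And>i. 0 \<le> occupancy M \<eta> Q y i"
    and thr: "threshold_structure M \<alpha> \<eta> Q y th mt"
    and g: "\<forall>i\<in>queue_states Q. \<forall>m\<in>{1..M}. 0 \<le> g i m \<and> g i m \<le> 1"
    and f: "\<forall>i\<in>queue_states Q - {0}. \<forall>m\<in>{1..M}. 0 \<le> f i m \<and> f i m \<le> 1"
    and rel: "transmission_relation M \<alpha> \<eta> Q y g f"
  shows "threshold_policy_on {i. 0 < occupancy M \<eta> Q y i} M \<alpha> \<eta> Q y th mt g f"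
proof -
  let ?A = "queue_states Q" and ?p = "occupancy M \<eta> Q y"
  have pos: "Suc i \<in> ?A" if "0 < odds \<alpha> * ?p (Suc i)" for i
    using that by (auto simp: occupancy_def split: if_splits)
  have scaled: "0 \<le> odds \<alpha> * ?p i" "0 < odds \<alpha> * ?p i \<longleftrightarrow> 0 < ?p i" for i
    using odds_pos[OF assms(1,2)] nonneg[of i] by (auto simp: zero_less_mult_iff)
  have y: "y i m = ?p i * g i m + odds \<alpha> * ?p (Suc i) * f (Suc i) m"
    if "i \<in> ?A" "m \<in> {1..M}" for i m
    using rel that by (simp add: transmission_relation_def)
  have zero: "(0 < ?p i \<longrightarrow> g i m = 0) \<and> (0 < ?p (Suc i) \<longrightarrow> f (Suc i) m = 0)"
    if "i \<in> ?A" "m \<in> {1..M}" "y i m = 0" for i m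
    using combination_eq_0D[of "?p i" "g i m" "odds \<alpha> * ?p (Suc i)" "f (Suc i) m"]
      y[OF that(1,2)] that nonneg scaled pos g f by auto
  have one: "(0 < ?p i \<longrightarrow> g i m = 1) \<and> (0 < ?p (Suc i) \<longrightarrow> f (Suc i) m = 1)"
    if "i \<in> ?A" "m \<in> {1..M}" "y i m = ?p i + odds \<alpha> * ?p (Suc i)" for i m
  proof -
    \<comment> \<open>Passing to the complements \<open>1 - g i m\<close> and
      \<open>1 - f (Suc i) m\<close> turns attainment of the upper bound into a vanishing
      combination, as in \<open>zero\<close>.\<close>
    have "?p i * (1 - g i m) + odds \<alpha> * ?p (Suc i) * (1 - f (Suc i) m) = 0"
      using y[OF that(1,2)] that(3) by (simp add: algebra_simps)
    from combination_eq_0D[OF this] show ?thesis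
      using that nonneg scaled pos g f by auto
  qed
  show ?thesis
  proof (rule threshold_policy_onI[OF _ _ rel])
    fix m i assume i: "m \<in> {1..M}" "i \<in> ?A"
    show "(i \<in> {i. 0 < ?p i} \<longrightarrow> g i m = 0) \<and> (i + 1 \<in> {i. 0 < ?p i} \<longrightarrow> f (i + 1) m = 0)"
      if "i + 1 < th m \<or> i + 1 = th m \<and> mt \<noteq> Some m"
    proof -
      have "y i m = 0"
        using threshold_structure_below[OF thr i(2,1)] thr i that
        unfolding threshold_structure_def by blast
      then show ?thesis using zero i by simp
    qed
    show "(i \<in> {i. 0 < ?p i} \<longrightarrow> g i m = 1) \<and> (i + 1 \<in> {i. 0 < ?p i} \<longrightarrow> f (i + 1) m = 1)"
      if "th m \<le> i"
    proof -
      have "y i m = ?p i + odds \<alpha> * ?p (i + 1)"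
        using thr i that unfolding threshold_structure_def by blast
      then show ?thesis using one i by simp
    qed
  qed
qed

theorem theorem5:
  fixes M :: nat and \<alpha> :: real and \<eta> P :: "nat \<Rightarrow> real" and Q :: enat and pmax :: real
    and y :: "nat \<Rightarrow> nat \<Rightarrow> real" and th :: "nat \<Rightarrow> nat" and mt :: "nat option"
  assumes "1 \<le> M"
    and "0 < \<alpha>" and "\<alpha> < 1"
    and "\<forall>m\<in>{1..M}. 0 \<le> \<eta> m" and "(\<Sum>m=1..M. \<eta> m) = 1"
    and "mono_on {1..M} P"
    and "0 < Q"
    and "lp_optimal M \<alpha> \<eta> P Q pmax y"
    and "lp_power M \<alpha> \<eta> P Q y = pmax"
    and "pmax < \<alpha> * (\<Sum>m=1..M. \<eta> m * P m)"
    and "\<forall>i. enat i = Q \<longrightarrow> occupancy M \<eta> Q y i = 0"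
    and "threshold_structure M \<alpha> \<eta> Q y th mt"
  shows "(\<forall>g f. sp_optimal M \<alpha> \<eta> P Q pmax g f (occupancy M \<eta> Q y) \<and>
                transmission_relation M \<alpha> \<eta> Q y g f \<longrightarrow>
                threshold_policy_on {i. 0 < occupancy M \<eta> Q y i} M \<alpha> \<eta> Q y th mt g f) \<and>
         (\<exists>g f. sp_optimal M \<alpha> \<eta> P Q pmax g f (occupancy M \<eta> Q y) \<and>
                transmission_relation M \<alpha> \<eta> Q y g f \<and>
                threshold_policy_on (queue_states Q) M \<alpha> \<eta> Q y th mt g f)"
proof -
  let ?A = "queue_states Q" and ?p = "occupancy M \<eta> Q y"
  note \<alpha> = assms(2,3) and opt = assms(8) and thr = assms(12)
  have y: "\<forall>i\<in>?A. \<forall>m\<in>{1..M}. 0 \<le> y i m \<and> y i m \<le> ?p i + odds \<alpha> * ?p (i + 1)"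
    using opt by (simp add: lp_optimal_def lp_feasible_def)
  then have nonneg: "0 \<le> ?p i" for i
    using assms(4) by (intro occupancy_nonneg) auto
  have "threshold_policy_on {i. 0 < ?p i} M \<alpha> \<eta> Q y th mt g f"
    if "sp_optimal M \<alpha> \<eta> P Q pmax g f ?p" "transmission_relation M \<alpha> \<eta> Q y g f" for g f
    using that(1) unfolding sp_optimal_def sp_feasible_def
    by (intro threshold_policy_forced[OF \<alpha> nonneg thr _ _ that(2)]) blast+
  moreover
  have "\<exists>g f. sp_optimal M \<alpha> \<eta> P Q pmax g f ?p \<and> transmission_relation M \<alpha> \<eta> Q y g f \<and>
      threshold_policy_on ?A M \<alpha> \<eta> Q y th mt g f"
  proof -
    \<comment> \<open>At \<open>mt\<close> a vanishing denominator forces \<open>y i m = 0\<close>, so the value 0 of the ratio is harmless.\<close>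
    define g where "g i m = (if th m \<le> i then 1
      else if i + 1 = th m \<and> mt = Some m then y i m / (?p i + odds \<alpha> * ?p (i + 1)) else 0)" for i m
    \<comment> \<open>The shift gives \<open>f (i + 1) m = g i m\<close>, the common ratio.
      Truncated subtraction sets \<open>f 0 m\<close> to \<open>g 0 m\<close>, a value outside the
      range of the model.\<close>
    define f where "f i m = g (i - 1) m" for i m
    have D: "0 \<le> ?p i + odds \<alpha> * ?p (i + 1)" for i
      using nonneg odds_pos[OF \<alpha>] by (simp add: add_nonneg_nonneg)
    have g01: "\<forall>i\<in>?A. \<forall>m\<in>{1..M}. 0 \<le> g i m \<and> g i m \<le> 1"
    proof (intro ballI)
      fix i m assume "i \<in> ?A" "m \<in> {1..M}"
      then have "0 \<le> y i m \<and> y i m \<le> ?p i + odds \<alpha> * ?p (i + 1)"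
        using y by blast
      then show "0 \<le> g i m \<and> g i m \<le> 1"
        using D[of i] unfolding g_def by (auto simp: divide_le_eq_1)
    qed
    have f01: "\<forall>i\<in>?A - {0}. \<forall>m\<in>{1..M}. 0 \<le> f i m \<and> f i m \<le> 1"
    proof (intro ballI)
      fix i m assume "i \<in> ?A - {0}" "m \<in> {1..M}"
      then obtain j where "i = Suc j" "j \<in> ?A"
        by (metis DiffE Suc_in_queue_states insertI1 not0_implies_Suc)
      then show "0 \<le> f i m \<and> f i m \<le> 1"
        using g01 \<open>m \<in> {1..M}\<close> by (simp add: f_def)
    qed
    \<comment> \<open>At or above the threshold \<open>y i m\<close> attains its upper bound and the
      ratio is 1; below it \<open>y i m = 0\<close>, except possibly just below the threshold of
      \<open>mt\<close>, where \<open>g\<close> is defined as the quotient.\<close>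
    have y_eq: "y i m = (?p i + odds \<alpha> * ?p (i + 1)) * g i m" if "i \<in> ?A" "m \<in> {1..M}" for i m
    proof -
      consider "th m \<le> i" | "i + 1 = th m" "mt = Some m" | "i + 1 = th m" "mt \<noteq> Some m"
        | "i + 1 < th m" by linarith
      then show ?thesis
      proof cases
        case 2
        moreover have "0 \<le> y i m \<and> y i m \<le> ?p i + odds \<alpha> * ?p (i + 1)"
          using y that by blast
        ultimately show ?thesis by (auto simp: g_def)
      next
        case 3
        then show ?thesis using threshold_structure_below[OF thr that] by (simp add: g_def)
      qed (use thr that in \<open>auto simp: threshold_structure_def g_def\<close>)
    qed
    have rel: "transmission_relation M \<alpha> \<eta> Q y g f"
      unfolding transmission_relation_def
      by (intro ballI) (subst y_eq, simp_all add: f_def distrib_right)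
    \<comment> \<open>The values 0 and 1 are built into \<open>g\<close> and \<open>f\<close> even
      at queue lengths of occupancy 0, so the clauses hold on the whole buffer.\<close>
    then have "threshold_policy_on ?A M \<alpha> \<eta> Q y th mt g f"
      by (intro threshold_policy_onI) (auto simp: f_def g_def)
    then show ?thesis
      using lp_optimal_imp_sp_optimal[OF \<alpha> assms(4,5) opt assms(11) g01 f01 rel] rel by blast
  qed
  ultimately show ?thesis by blast
qed

end
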